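(* Let $\Gamma$ be a graph and, for $i=1,2$, let $(X_i,p_i,\Gamma)$ be an $F_i$-graph bundle with the same base $\Gamma$. Then the triple $(X_1\boxplus X_2,(p_1,p_2),\Gamma)$ is an $F_1\,\square\,F_2$-graph bundle.
   Context: Graphs are simple and undirected: $\Gamma=(V_\Gamma,E_\Gamma)$ with $E_\Gamma$ a set of unordered pairs of distinct vertices; $v\sim w$ means $\{v,w\}\in E_\Gamma$. A morphism of graphs $f:\Gamma_1\to\Gamma_2$ is a function $f:V_{\Gamma_1}\to V_{\Gamma_2}$ such that $v\sim w$ implies $f(v)\sim f(w)$ or $f(v)=f(w)$; it is surjective if it is surjective on vertices. An isomorphism of graphs is a bijection on vertices with $v\sim w$ iff $f(v)\sim f(w)$. The Cartesian product $F_1\,\square\,F_2$ has vertex set $V_{F_1}\times V_{F_2}$, with $(a,b)\sim(a',b')$ iff ($a\sim a'$ and $b=b'$) or ($a=a'$ and $b\sim b'$). The neighborhood $N(v)$ of a vertex $v$ is the graph with vertices $v$ and all $w\sim v$, and edges $\{v,w\}$ for $w\sim v$. For a natural number $k$, a triple $(\widetilde\Gamma,p,\Gamma)$ with $p:\widetilde\Gamma\to\Gamma$ a surjective morphism of graphs is a $k$-fold covering if each $p^{-1}(v)$ has exactly $k$ vertices and, for each vertex $x$ of $\widetilde\Gamma$, $p$ restricts to an isomorphism $N(x)\to N(p(x))$. For $v\sim w$ in $\Gamma$ the covering induces a bijection $\psi_{vw}:p^{-1}(v)\to p^{-1}(w)$ sending $x$ to the unique neighbour of $x$ in $\widetilde\Gamma$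 lying over $w$. Graph bundles. Let $p:X\to\Gamma$ be a surjective morphism of graphs. The fiber $p^{-1}(v)$ is the subgraph of $X$ induced on the preimage of $v$. Let $\widetilde X$ be the graph with vertex set $V_X$ whose edges are the edges $\{x,y\}$ of $X$ with $p(x)\ne p(y)$, and let $\widetilde p:\widetilde X\to\Gamma$ be the map $p$. Given a graph $F$, $(X,p,\Gamma)$ is an $F$-graph bundle if (1) each fiber $p^{-1}(v)$ is isomorphic to $F$; (2) $\widetilde p:\widetilde X\to\Gamma$ is a $|V_F|$-fold covering; (3) for all $v\sim w$ in $\Gamma$ the bijection $\psi_{vw}:p^{-1}(v)\to p^{-1}(w)$ induced by this covering is an isomorphism of graphs. The graph $X_1\boxplus X_2$ is the total space of the pullback of $(X_2,p_2,\Gamma)$ along $p_1:X_1\to\Gamma$: its vertex set is $\{(x,y)\in V_{X_1}\times V_{X_2}:p_1(x)=p_2(y)\}$, and $(x,y)\sim(x',y')$ iff one of: (I) $x=x'$ and $y\sim y'$; (II) $x\sim x'$, $p_1(x)=p_1(x')$ and $y=y'$; (III) $x\sim x'$, $p_1(x)\sim p_1(x')$ and $y\sim y'$. The map $(p_1,p_2):X_1\boxplus X_2\to\Gamma$ is $(x,y)\mapsto p_1(x)=p_2(y)$. *)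

theory Defs
  imports Main
begin

record 'a ugraph =
  verts :: "'a set"
  edges :: "'a set set"

definition simple_graph :: "'a ugraph \<Rightarrow> bool" where
  "simple_graph G \<longleftrightarrow> edges G \<subseteq> {{v, w} | v w. v \<in> verts G \<and> w \<in> verts G \<and> v \<noteq> w}"

abbreviation adj :: "'a ugraph \<Rightarrow> 'a \<Rightarrow> 'a \<Rightarrow> bool" where
  "adj G v w \<equiv> {v, w} \<in> edges G"

definition graph_morphism :: "'a ugraph \<Rightarrow> 'b ugraph \<Rightarrow> ('a \<Rightarrow> 'b) \<Rightarrow> bool" where
  "graph_morphism G H f \<longleftrightarrow>
     f ` verts G \<subseteq> verts H \<and>
     (\<forall>v\<in>verts G. \<forall>w\<in>verts G. adj G v w \<longrightarrow> adj H (f v) (f w) \<or> f v = f w)"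

definition surj_graph_morphism :: "'a ugraph \<Rightarrow> 'b ugraph \<Rightarrow> ('a \<Rightarrow> 'b) \<Rightarrow> bool" where
  "surj_graph_morphism G H f \<longleftrightarrow> graph_morphism G H f \<and> f ` verts G = verts H"

text \<open>Only the values of \<open>f\<close> on \<open>verts G\<close> matter, so the same predicate also
  expresses that the restriction of a map to a subgraph is an isomorphism.\<close>

definition graph_iso :: "'a ugraph \<Rightarrow> 'b ugraph \<Rightarrow> ('a \<Rightarrow> 'b) \<Rightarrow> bool" where
  "graph_iso G H f \<longleftrightarrow>
     bij_betw f (verts G) (verts H) \<and>
     (\<forall>v\<in>verts G. \<forall>w\<in>verts G. adj G v w \<longleftrightarrow> adj H (f v) (f w))"

definition isomorphic :: "'a ugraph \<Rightarrow> 'b ugraph \<Rightarrow> bool" where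
  "isomorphic G H \<longleftrightarrow> (\<exists>f. graph_iso G H f)"

definition cart_prod :: "'a ugraph \<Rightarrow> 'b ugraph \<Rightarrow> ('a \<times> 'b) ugraph" where
  "cart_prod F1 F2 =
     \<lparr>verts = verts F1 \<times> verts F2,
      edges = {{(a, b), (a', b')} | a b a' b'.
        (a, b) \<in> verts F1 \<times> verts F2 \<and> (a', b') \<in> verts F1 \<times> verts F2 \<and>
        (adj F1 a a' \<and> b = b' \<or> a = a' \<and> adj F2 b b')}\<rparr>"

text \<open>The star at \<open>v\<close>: edges between two neighbours of \<open>v\<close> are not included.\<close>

definition neighborhood :: "'a ugraph \<Rightarrow> 'a \<Rightarrow> 'a ugraph" where
  "neighborhood G v =
     \<lparr>verts = insert v {w \<in> verts G. adj G v w},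
      edges = {{v, w} | w. w \<in> verts G \<and> adj G v w}\<rparr>"

definition preimage :: "'a ugraph \<Rightarrow> ('a \<Rightarrow> 'b) \<Rightarrow> 'b \<Rightarrow> 'a set" where
  "preimage X p v = {x \<in> verts X. p x = v}"

definition k_fold_covering :: "nat \<Rightarrow> 'a ugraph \<Rightarrow> ('a \<Rightarrow> 'b) \<Rightarrow> 'b ugraph \<Rightarrow> bool" where
  "k_fold_covering k X p G \<longleftrightarrow>
     simple_graph X \<and> simple_graph G \<and> surj_graph_morphism X G p \<and>
     (\<forall>v\<in>verts G. finite (preimage X p v) \<and> card (preimage X p v) = k) \<and>
     (\<forall>x\<in>verts X. graph_iso (neighborhood X x) (neighborhood G (p x)) p)"

text \<open>The bijection \<open>\<psi>\<^sub>v\<^sub>w\<close> induced by a covering; the index \<open>v\<close> is determined by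
  the argument, as \<open>v = p x\<close>.\<close>

definition covering_transport :: "'a ugraph \<Rightarrow> ('a \<Rightarrow> 'b) \<Rightarrow> 'b \<Rightarrow> 'a \<Rightarrow> 'a" where
  "covering_transport X p w x = (THE y. y \<in> preimage X p w \<and> adj X x y)"

definition fiber :: "'a ugraph \<Rightarrow> ('a \<Rightarrow> 'b) \<Rightarrow> 'b \<Rightarrow> 'a ugraph" where
  "fiber X p v =
     \<lparr>verts = preimage X p v, edges = {e \<in> edges X. e \<subseteq> preimage X p v}\<rparr>"

definition horizontal_graph :: "'a ugraph \<Rightarrow> ('a \<Rightarrow> 'b) \<Rightarrow> 'a ugraph" where
  "horizontal_graph X p =
     \<lparr>verts = verts X, edges = {{x, y} | x y. adj X x y \<and> p x \<noteq> p y}\<rparr>"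

text \<open>Coverings are \<open>k\<close>-fold for natural numbers \<open>k\<close>, so \<open>|V\<^sub>F|\<close> must be one:
  finiteness of \<open>F\<close> is stated because \<open>card\<close> of an infinite set is \<open>0\<close>.
  The base \<open>G\<close> and total space \<open>X\<close> may be infinite.\<close>

definition graph_bundle ::
  "'f ugraph \<Rightarrow> 'a ugraph \<Rightarrow> ('a \<Rightarrow> 'b) \<Rightarrow> 'b ugraph \<Rightarrow> bool" where
  "graph_bundle F X p G \<longleftrightarrow>
     simple_graph F \<and> finite (verts F) \<and> simple_graph X \<and> simple_graph G \<and>
     surj_graph_morphism X G p \<and>
     (\<forall>v\<in>verts G. isomorphic (fiber X p v) F) \<and>
     k_fold_covering (card (verts F)) (horizontal_graph X p) p G \<and>
     (\<forall>v\<in>verts G. \<forall>w\<in>verts G. adj G v w \<longrightarrow>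
        graph_iso (fiber X p v) (fiber X p w)
          (covering_transport (horizontal_graph X p) p w))"

definition boxplus ::
  "'a ugraph \<Rightarrow> ('a \<Rightarrow> 'c) \<Rightarrow> 'b ugraph \<Rightarrow> ('b \<Rightarrow> 'c) \<Rightarrow> 'c ugraph \<Rightarrow> ('a \<times> 'b) ugraph" where
  "boxplus X1 p1 X2 p2 G =
     (let V = {(x, y). x \<in> verts X1 \<and> y \<in> verts X2 \<and> p1 x = p2 y} in
      \<lparr>verts = V,
       edges = {{(x, y), (x', y')} | x y x' y'.
         (x, y) \<in> V \<and> (x', y') \<in> V \<and>
         (x = x' \<and> adj X2 y y' \<or>
          adj X1 x x' \<and> p1 x = p1 x' \<and> y = y' \<or>
          adj X1 x x' \<and> adj G (p1 x) (p1 x') \<and> adj X2 y y')}\<rparr>)"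

text \<open>The map \<open>(p\<^sub>1, p\<^sub>2)\<close>; on vertices of the total space \<open>p1 x = p2 y\<close>, so \<open>p2\<close>
  does not occur.\<close>

definition boxplus_proj :: "('a \<Rightarrow> 'c) \<Rightarrow> 'a \<times> 'b \<Rightarrow> 'c" where
  "boxplus_proj p1 = (\<lambda>(x, y). p1 x)"

end

(* A covering is the same as unique lifting of edges at every vertex.  Horizontal
   edges of the pullback are pairs of horizontal edges over a common edge of the base,
   so unique lifts pair up and the transport is the product of the two transports.
   Since the base has no loops, the fiber of the pullback is the Cartesian product of
   the two fibers, and a product of isomorphisms is an isomorphism of Cartesian
   products. *)
theory Submission
  imports Defs
begin

section \<open>Simple graphs, stars and unique lifting of edges\<close>

lemma simple_graph_adjD:
  assumes "simple_graph G" "adj G v w"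
  shows "v \<in> verts G" "w \<in> verts G" "v \<noteq> w"
proof -
  obtain a b where "{v, w} = {a, b}" "a \<in> verts G" "b \<in> verts G" "a \<noteq> b"
    using assms unfolding simple_graph_def by blast
  then show "v \<in> verts G" "w \<in> verts G" "v \<noteq> w"
    by (auto simp: doubleton_eq_iff)
qed

lemma adj_commute: "adj G v w \<longleftrightarrow> adj G w v"
  by (simp add: insert_commute)

lemma adj_neighborhood:
  assumes "simple_graph G"
  shows "adj (neighborhood G v) a b \<longleftrightarrow> adj G a b \<and> (a = v \<or> b = v)"
  using simple_graph_adjD[OF assms]
  by (auto simp: neighborhood_def doubleton_eq_iff insert_commute)

lemma verts_neighborhood:
  assumes "simple_graph G"
  shows "verts (neighborhood G v) = insert v {w. adj G v w}"
  using simple_graph_adjD[OF assms] by (auto simp: neighborhood_def)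

text \<open>A star is determined by its centre and its leaves, and \<open>p\<close> respects
  centres, so the isomorphism condition amounts to a bijection between the two sets of leaves. The
  first conjunct sends leaves to leaves; in the second, existence of lifts is surjectivity and
  uniqueness is injectivity. The absence of loops keeps leaves apart from centres.\<close>

lemma star_iso_iff_unique_lifts:
  assumes X: "simple_graph X" and G: "simple_graph G"
  shows "graph_iso (neighborhood X x) (neighborhood G (p x)) p \<longleftrightarrow>
    (\<forall>y. adj X x y \<longrightarrow> adj G (p x) (p y)) \<and>
    (\<forall>w. adj G (p x) w \<longrightarrow> (\<exists>!y. adj X x y \<and> p y = w))" (is "?L \<longleftrightarrow> ?R1 \<and> ?R2")
proof
  assume L: ?L
  then have inj: "inj_on p (insert x {y. adj X x y})"
    and im: "p ` insert x {y. adj X x y} = insert (p x) {w. adj G (p x) w}"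
    by (simp_all add: graph_iso_def bij_betw_def verts_neighborhood X G)
  have R1: ?R1
  proof (intro allI impI)
    fix y assume y: "adj X x y"
    then have "p y \<noteq> p x"
      using inj simple_graph_adjD(3)[OF X y] by (auto simp: inj_on_def)
    then show "adj G (p x) (p y)" using im y by blast
  qed
  have ?R2
  proof (intro allI impI)
    fix w assume w: "adj G (p x) w"
    then have "w \<noteq> p x" using simple_graph_adjD(3)[OF G w] by simp
    moreover have "w \<in> p ` insert x {y. adj X x y}" using im w by blast
    ultimately obtain y where "adj X x y" "p y = w" by blast
    then show "\<exists>!y. adj X x y \<and> p y = w"
      using inj by (auto simp: inj_on_def)
  qed
  with R1 show "?R1 \<and> ?R2" ..
next
  assume R: "?R1 \<and> ?R2"
  have ne: "p x \<noteq> p y" if "adj X x y" for y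
    using R that simple_graph_adjD(3)[OF G] by blast
  have "inj_on p (insert x {y. adj X x y})"
    using R ne by (fastforce simp: inj_on_def)
  moreover have "p ` insert x {y. adj X x y} = insert (p x) {w. adj G (p x) w}"
    using R by blast
  moreover have "adj (neighborhood X x) a b \<longleftrightarrow> adj (neighborhood G (p x)) (p a) (p b)"
    if ab: "a \<in> insert x {y. adj X x y}" "b \<in> insert x {y. adj X x y}" for a b
  proof -
    have "\<not> adj X x x" "\<not> adj G (p x) (p x)"
      using simple_graph_adjD(3)[OF X] simple_graph_adjD(3)[OF G] by blast+
    then consider "a = x" "b = x" | "a = x" "adj X x b" | "b = x" "adj X x a"
      | "a \<noteq> x" "b \<noteq> x" "adj X x a" "adj X x b"
      using ab by blast
    then have "adj X a b \<and> (a = x \<or> b = x) \<longleftrightarrow> adj G (p a) (p b) \<and> (p a = p x \<or> p b = p x)"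
      (is ?edge)
    proof cases
      case 1
      with \<open>\<not> adj X x x\<close> \<open>\<not> adj G (p x) (p x)\<close> show
        ?edge by blast
    next
      case 2
      with R show ?edge
        by blast
    next
      case 3
      with R show ?edge
        using adj_commute[of a x X] adj_commute[of "p a" "p x" G] by blast
    next
      \<comment> \<open>\<open>X\<close> may well contain the edge \<open>{a, b}\<close> between two
        leaves, but it does not belong to the star. By \<open>ne\<close> neither leaf is mapped to
        the centre \<open>p x\<close>, so both sides are false.\<close>
      case 4
      with ne[of a] ne[of b]
      show ?edge
        by auto
    qed
    then show ?thesis unfolding adj_neighborhood[OF X] adj_neighborhood[OF G] .
  qed
  ultimately show ?L
    unfolding graph_iso_def bij_betw_def verts_neighborhood[OF X] verts_neighborhood[OF G]
    by blast
qed

section \<open>The horizontal graph, its coverings and their transport\<close>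

lemma verts_horizontal [simp]: "verts (horizontal_graph X p) = verts X"
  by (simp add: horizontal_graph_def)

lemma adj_horizontal: "adj (horizontal_graph X p) x y \<longleftrightarrow> adj X x y \<and> p x \<noteq> p y"
  by (auto simp: horizontal_graph_def doubleton_eq_iff insert_commute)

lemma preimage_horizontal [simp]: "preimage (horizontal_graph X p) p = preimage X p"
  by (simp add: preimage_def fun_eq_iff)

lemma simple_graph_horizontal:
  assumes "simple_graph X"
  shows "simple_graph (horizontal_graph X p)"
  unfolding simple_graph_def
proof
  fix e assume "e \<in> edges (horizontal_graph X p)"
  then have "e \<in> edges X" by (auto simp: horizontal_graph_def)
  then show "e \<in> {{v, w} |v w. v \<in> verts (horizontal_graph X p)
      \<and> w \<in> verts (horizontal_graph X p) \<and> v \<noteq> w}"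
    using assms unfolding simple_graph_def by (auto dest: subsetD)
qed

lemma surj_morphism_horizontal:
  "surj_graph_morphism X G p \<Longrightarrow> surj_graph_morphism (horizontal_graph X p) G p"
  by (auto simp: surj_graph_morphism_def graph_morphism_def adj_horizontal)

text \<open>The endpoints of an edge of the loopless base differ, so every lift of it is horizontal,
  and lifts may be sought in \<open>X\<close> itself. The other half of the star criterion is
  automatic: a morphism maps an edge to an edge or to a single vertex, and a horizontal edge
  excludes the latter.\<close>

lemma horizontal_covering_iff:
  assumes "simple_graph X" "simple_graph G" "surj_graph_morphism X G p"
  shows "k_fold_covering k (horizontal_graph X p) p G \<longleftrightarrow>
    (\<forall>v\<in>verts G. finite (preimage X p v) \<and> card (preimage X p v) = k) \<and>
    (\<forall>x\<in>verts X. \<forall>w. adj G (p x) w \<longrightarrow> (\<exists>!y. adj X x y \<and> p y = w))"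
proof -
  note H = simple_graph_horizontal[OF assms(1), of p]
  have edge: "adj (horizontal_graph X p) x y \<longrightarrow> adj G (p x) (p y)" for x y
    using assms(3) simple_graph_adjD[OF assms(1), of x y]
    unfolding adj_horizontal surj_graph_morphism_def graph_morphism_def by blast
  have lift: "adj (horizontal_graph X p) x y \<and> p y = w \<longleftrightarrow> adj X x y \<and> p y = w"
    if "adj G (p x) w" for x y w
    using simple_graph_adjD(3)[OF assms(2) that] by (auto simp: adj_horizontal)
  show ?thesis
    unfolding k_fold_covering_def star_iso_iff_unique_lifts[OF H assms(2)]
    using H assms surj_morphism_horizontal[OF assms(3)] edge
    \<comment> \<open>The rewrite \<open>lift\<close> is conditional on
      \<open>adj G (p x) w\<close>; \<open>imp_cong\<close> makes this premise available while the
      unique-existence statement is simplified.\<close>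
    by (simp add: lift cong: conj_cong imp_cong)
qed

text \<open>Reduces the definite description in \<open>covering_transport\<close> to exhibiting one
  lift in \<open>X\<close>; the hypothesis \<open>p x \<noteq> w\<close> is what makes that lift
  horizontal.\<close>

lemma transport_eqI:
  assumes "simple_graph X" "\<exists>!y. adj X x y \<and> p y = w" "adj X x y" "p y = w" "p x \<noteq> w"
  shows "covering_transport (horizontal_graph X p) p w x = y"
  unfolding covering_transport_def preimage_horizontal
proof (rule the_equality)
  show "y \<in> preimage X p w \<and> adj (horizontal_graph X p) x y"
    using assms simple_graph_adjD(2)[OF assms(1,3)] by (auto simp: preimage_def adj_horizontal)
  show "z = y" if "z \<in> preimage X p w \<and> adj (horizontal_graph X p) x z" for z
    using that assms by (auto simp: preimage_def adj_horizontal)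
qed

section \<open>Graph isomorphisms and Cartesian products\<close>

lemma graph_iso_cong:
  assumes "\<And>x. x \<in> verts G \<Longrightarrow> f x = g x"
  shows "graph_iso G H f \<longleftrightarrow> graph_iso G H g"
  unfolding graph_iso_def using assms by (simp cong: bij_betw_cong)

lemma verts_cart_prod [simp]: "verts (cart_prod A B) = verts A \<times> verts B"
  by (simp add: cart_prod_def)

lemma adj_cart_prod:
  "adj (cart_prod A B) (a, b) (a', b') \<longleftrightarrow>
     a \<in> verts A \<and> b \<in> verts B \<and> a' \<in> verts A \<and> b' \<in> verts B \<and>
     (adj A a a' \<and> b = b' \<or> a = a' \<and> adj B b b')"
  by (auto simp: cart_prod_def doubleton_eq_iff insert_commute)

lemma simple_graph_cart_prod:
  assumes "simple_graph A" "simple_graph B"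
  shows "simple_graph (cart_prod A B)"
  unfolding simple_graph_def
proof
  fix e assume "e \<in> edges (cart_prod A B)"
  then obtain a b a' b' where e: "e = {(a, b), (a', b')}"
    "(a, b) \<in> verts A \<times> verts B" "(a', b') \<in> verts A \<times> verts B"
    "adj A a a' \<and> b = b' \<or> a = a' \<and> adj B b b'"
    by (auto simp: cart_prod_def)
  then have "(a, b) \<noteq> (a', b')"
    using simple_graph_adjD(3)[OF assms(1)] simple_graph_adjD(3)[OF assms(2)] by blast
  with e show "e \<in> {{v, w} |v w. v \<in> verts (cart_prod A B)
      \<and> w \<in> verts (cart_prod A B) \<and> v \<noteq> w}"
    unfolding verts_cart_prod by blast
qed

text \<open>Serves both for the shape of the fibers and for the transport between them. Adjacency in
  the product also tests coordinates for equality, and injectivity of \<open>f\<close> and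
  \<open>g\<close> is what reflects these equalities.\<close>

lemma graph_iso_cart_prod:
  assumes f: "graph_iso A A' f" and g: "graph_iso B B' g"
  shows "graph_iso (cart_prod A B) (cart_prod A' B') (map_prod f g)"
proof -
  have bij: "bij_betw f (verts A) (verts A')" "bij_betw g (verts B) (verts B')"
    using f g by (simp_all add: graph_iso_def)
  have eq: "f a = f a' \<longleftrightarrow> a = a'" if "a \<in> verts A" "a' \<in> verts A" for a a'
    using bij(1) that by (auto simp: bij_betw_def inj_on_def)
  have eq': "g b = g b' \<longleftrightarrow> b = b'" if "b \<in> verts B" "b' \<in> verts B" for b b'
    using bij(2) that by (auto simp: bij_betw_def inj_on_def)
  have "f a \<in> verts A'" if "a \<in> verts A" for a using bij(1) that by (auto simp: bij_betw_def)
  moreover have "g b \<in> verts B'" if "b \<in> verts B" for b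
    using bij(2) that by (auto simp: bij_betw_def)
  moreover have "bij_betw (map_prod f g) (verts A \<times> verts B) (verts A' \<times> verts B')"
    using bij by (auto simp: bij_betw_def map_prod_inj_on map_prod_surj_on)
  ultimately show ?thesis
    using f g by (auto simp: graph_iso_def adj_cart_prod eq eq')
qed

section \<open>The pullback and its fibers\<close>

lemma verts_boxplus:
  "verts (boxplus X1 p1 X2 p2 G) = {(x, y). x \<in> verts X1 \<and> y \<in> verts X2 \<and> p1 x = p2 y}"
  by (simp add: boxplus_def Let_def)

text \<open>An unordered pair can match the defining comprehension in either order; each of the
  three clauses is symmetric in the endpoints, so both orders give the same condition.\<close>

lemma adj_boxplus:
  "adj (boxplus X1 p1 X2 p2 G) (x, y) (x', y') \<longleftrightarrow>
     x \<in> verts X1 \<and> y \<in> verts X2 \<and> p1 x = p2 y \<and>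
     x' \<in> verts X1 \<and> y' \<in> verts X2 \<and> p1 x' = p2 y' \<and>
     (x = x' \<and> adj X2 y y' \<or> adj X1 x x' \<and> p1 x = p1 x' \<and> y = y' \<or>
      adj X1 x x' \<and> adj G (p1 x) (p1 x') \<and> adj X2 y y')"
  by (auto simp: boxplus_def Let_def doubleton_eq_iff insert_commute)

lemma simple_graph_boxplus:
  assumes "simple_graph X1" "simple_graph X2"
  shows "simple_graph (boxplus X1 p1 X2 p2 G)" (is "simple_graph ?B")
  unfolding simple_graph_def
proof
  fix e assume e: "e \<in> edges ?B"
  then obtain x y x' y' where e': "e = {(x, y), (x', y')}"
    by (auto simp: boxplus_def Let_def)
  with e have adj: "adj ?B (x, y) (x', y')" by simp
  then have "(x, y) \<in> verts ?B" "(x', y') \<in> verts ?B"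
    unfolding adj_boxplus verts_boxplus by auto
  moreover have "(x, y) \<noteq> (x', y')"
    using adj simple_graph_adjD(3)[OF assms(1)] simple_graph_adjD(3)[OF assms(2)]
    unfolding adj_boxplus by blast
  ultimately show "e \<in> {{v, w} |v w. v \<in> verts ?B \<and> w \<in> verts ?B \<and> v \<noteq> w}"
    unfolding e' by blast
qed

lemma preimage_boxplus:
  "preimage (boxplus X1 p1 X2 p2 G) (boxplus_proj p1) v = preimage X1 p1 v \<times> preimage X2 p2 v"
  by (auto simp: preimage_def verts_boxplus boxplus_proj_def)

text \<open>Within the fiber over \<open>v\<close> the third kind of edge would need a loop of
  \<open>G\<close> at \<open>v\<close>; the first two kinds are exactly the edges of the Cartesian
  product. The result is an equality of graphs, so it can be used by unfolding.\<close>

lemma fiber_boxplus: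
  assumes "simple_graph G"
  shows "fiber (boxplus X1 p1 X2 p2 G) (boxplus_proj p1) v
    = cart_prod (fiber X1 p1 v) (fiber X2 p2 v)" (is "?L = ?R")
proof -
  have pair: "adj ?L (x, y) (x', y') \<longleftrightarrow> adj ?R (x, y) (x', y')" for x y x' y'
    using simple_graph_adjD(3)[OF assms, of v v]
    by (auto simp: fiber_def preimage_boxplus adj_boxplus adj_cart_prod)
      (auto simp: preimage_def)
  \<comment> \<open>Every edge on either side is a set \<open>{(x, y), (x', y')}\<close>, so
    \<open>pair\<close> settles membership.\<close>
  have "edges ?L = edges ?R"
  proof (intro set_eqI iffI)
    fix e assume e: "e \<in> edges ?L"
    then obtain x y x' y' where "e = {(x, y), (x', y')}"
      by (auto simp: fiber_def boxplus_def Let_def)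
    with e pair show "e \<in> edges ?R" by metis
  next
    fix e assume e: "e \<in> edges ?R"
    then obtain x y x' y' where "e = {(x, y), (x', y')}"
      by (auto simp: cart_prod_def)
    with e pair show "e \<in> edges ?L" by metis
  qed
  moreover have "verts ?L = verts ?R"
    by (simp add: fiber_def preimage_boxplus)
  ultimately show ?thesis by simp
qed

section \<open>The bundle axioms for the pullback\<close>

theorem theorem4p1:
  fixes \<Gamma> :: "'c ugraph"
    and X1 :: "'a ugraph" and p1 :: "'a \<Rightarrow> 'c" and F1 :: "'f ugraph"
    and X2 :: "'b ugraph" and p2 :: "'b \<Rightarrow> 'c" and F2 :: "'g ugraph"
  assumes "simple_graph \<Gamma>"
    and "graph_bundle F1 X1 p1 \<Gamma>"
    and "graph_bundle F2 X2 p2 \<Gamma>"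
  shows "graph_bundle (cart_prod F1 F2) (boxplus X1 p1 X2 p2 \<Gamma>) (boxplus_proj p1) \<Gamma>"
proof -
  let ?B = "boxplus X1 p1 X2 p2 \<Gamma>" and ?p = "boxplus_proj p1 :: 'a \<times> 'b \<Rightarrow> 'c"
  note G = assms(1)
  have F1: "simple_graph F1" "finite (verts F1)" and X1: "simple_graph X1"
    and s1: "surj_graph_morphism X1 \<Gamma> p1"
    and iso1: "\<And>v. v \<in> verts \<Gamma> \<Longrightarrow> isomorphic (fiber X1 p1 v) F1"
    and c1: "k_fold_covering (card (verts F1)) (horizontal_graph X1 p1) p1 \<Gamma>"
    and t1: "\<And>v w. adj \<Gamma> v w \<Longrightarrow> graph_iso (fiber X1 p1 v) (fiber X1 p1 w)
          (covering_transport (horizontal_graph X1 p1) p1 w)"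
    using assms(2) simple_graph_adjD[OF G] unfolding graph_bundle_def by blast+
  have F2: "simple_graph F2" "finite (verts F2)" and X2: "simple_graph X2"
    and s2: "surj_graph_morphism X2 \<Gamma> p2"
    and iso2: "\<And>v. v \<in> verts \<Gamma> \<Longrightarrow> isomorphic (fiber X2 p2 v) F2"
    and c2: "k_fold_covering (card (verts F2)) (horizontal_graph X2 p2) p2 \<Gamma>"
    and t2: "\<And>v w. adj \<Gamma> v w \<Longrightarrow> graph_iso (fiber X2 p2 v) (fiber X2 p2 w)
          (covering_transport (horizontal_graph X2 p2) p2 w)"
    using assms(3) simple_graph_adjD[OF G] unfolding graph_bundle_def by blast+
  note B = simple_graph_boxplus[OF X1 X2, of p1 p2 \<Gamma>]
  note c1 = c1[unfolded horizontal_covering_iff[OF X1 G s1]]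
  note c2 = c2[unfolded horizontal_covering_iff[OF X2 G s2]]
  have surj: "surj_graph_morphism ?B \<Gamma> ?p"
  proof -
    have "p1 ` verts X1 = verts \<Gamma>" "p2 ` verts X2 = verts \<Gamma>"
      using s1 s2 by (auto simp: surj_graph_morphism_def)
    then have "?p ` verts ?B \<subseteq> verts \<Gamma>"
      by (auto simp: verts_boxplus boxplus_proj_def)
    \<comment> \<open>Any point of \<open>X1\<close> over \<open>v\<close> may be paired with any
      point of \<open>X2\<close> over \<open>v\<close>.\<close>
    moreover have "v \<in> ?p ` verts ?B" if v: "v \<in> verts \<Gamma>" for v
    proof -
      have "v \<in> p1 ` verts X1" "v \<in> p2 ` verts X2"
        using v \<open>p1 ` verts X1 = verts \<Gamma>\<close> \<open>p2 ` verts X2 = verts \<Gamma>\<close> by simp_all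
      then obtain x y where "x \<in> verts X1" "p1 x = v" "y \<in> verts X2" "p2 y = v"
        by fastforce
      then show ?thesis
        by (intro image_eqI[of _ _ "(x, y)"]) (auto simp: verts_boxplus boxplus_proj_def)
    qed
    ultimately have "?p ` verts ?B = verts \<Gamma>" by blast
    moreover have "adj \<Gamma> (?p z) (?p z') \<or> ?p z = ?p z'" if "adj ?B z z'" for z z'
      using that by (cases z; cases z') (auto simp: adj_boxplus boxplus_proj_def)
    ultimately show ?thesis
      unfolding surj_graph_morphism_def graph_morphism_def by blast
  qed
  have lift1: "\<exists>!u. adj X1 x u \<and> p1 u = w" if "x \<in> verts X1" "adj \<Gamma> (p1 x) w" for x w
    using c1 that by blast
  have lift2: "\<exists>!u. adj X2 y u \<and> p2 u = w" if "y \<in> verts X2" "adj \<Gamma> (p2 y) w" for y w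
    using c2 that by blast
  \<comment> \<open>The coordinates of the lift are recorded here because the transport needs them;
    \<open>lift\<close> below keeps only unique existence.\<close>
  have lifts: "\<exists>x' y'. adj X1 x x' \<and> p1 x' = w \<and> adj X2 y y' \<and> p2 y' = w
      \<and> adj ?B (x, y) (x', y') \<and> (\<forall>z. adj ?B (x, y) z \<and> ?p z = w \<longrightarrow> z = (x', y'))"
    if v: "(x, y) \<in> verts ?B" and w: "adj \<Gamma> (p1 x) w" for x y w
  proof -
    have xy: "x \<in> verts X1" "y \<in> verts X2" "p2 y = p1 x" using v by (auto simp: verts_boxplus)
    have w2: "adj \<Gamma> (p2 y) w" using w xy by simp
    have ex: "\<exists>!u. adj X1 x u \<and> p1 u = w" "\<exists>!u. adj X2 y u \<and> p2 u = w"
      using lift1[OF xy(1) w] lift2[OF xy(2) w2] .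
    obtain x' where x': "adj X1 x x'" "p1 x' = w" "\<And>u. adj X1 x u \<Longrightarrow> p1 u = w \<Longrightarrow> u = x'"
      using ex(1) by metis
    obtain y' where y': "adj X2 y y'" "p2 y' = w" "\<And>u. adj X2 y u \<Longrightarrow> p2 u = w \<Longrightarrow> u = y'"
      using ex(2) by metis
    have "adj ?B (x, y) (x', y')"
      unfolding adj_boxplus
      using x'(1,2) y'(1,2) xy w simple_graph_adjD(2)[OF X1 x'(1)]
        simple_graph_adjD(2)[OF X2 y'(1)] by simp
    \<comment> \<open>An edge of the first or second kind stays in one fiber, whereas
      \<open>p1 x \<noteq> w\<close>. Hence \<open>z\<close> comes from an edge of the third kind,
      and each of its coordinates is itself a lift.\<close>
    moreover have "z = (x', y')" if "adj ?B (x, y) z" "?p z = w" for z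
    proof -
      obtain a b where z: "z = (a, b)" by (cases z)
      then show ?thesis
        using that x'(3)[of a] y'(3)[of b] simple_graph_adjD(3)[OF G w] xy
        by (auto simp: adj_boxplus boxplus_proj_def)
    qed
    ultimately show ?thesis using x'(1,2) y'(1,2) by blast
  qed
  have lift: "\<exists>!z'. adj ?B z z' \<and> ?p z' = w" if "z \<in> verts ?B" "adj \<Gamma> (?p z) w" for z w
  proof -
    obtain x y where z: "z = (x, y)" by (cases z)
    then have "adj \<Gamma> (p1 x) w" using that(2) by (simp add: boxplus_proj_def)
    from lifts[OF that(1)[unfolded z] this] obtain x' y' where l: "p1 x' = w"
      "adj ?B (x, y) (x', y')" "\<forall>u. adj ?B (x, y) u \<and> ?p u = w \<longrightarrow> u = (x', y')"
      by blast
    have "?p (x', y') = w" using l(1) by (simp add: boxplus_proj_def)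
    with l(2,3) show ?thesis unfolding z by blast
  qed
  \<comment> \<open>Preimages of a vertex are products of finite sets, so the numbers of sheets
    multiply.\<close>
  have cover: "k_fold_covering (card (verts (cart_prod F1 F2))) (horizontal_graph ?B ?p) ?p \<Gamma>"
    unfolding horizontal_covering_iff[OF B G surj] preimage_boxplus
    using c1 c2 lift by (auto simp: card_cartesian_product)
  have iso: "isomorphic (fiber ?B ?p v) (cart_prod F1 F2)" if "v \<in> verts \<Gamma>" for v
    using iso1[OF that] iso2[OF that] graph_iso_cart_prod
    unfolding fiber_boxplus[OF G] isomorphic_def by blast
  have transport: "graph_iso (fiber ?B ?p v) (fiber ?B ?p w)
      (covering_transport (horizontal_graph ?B ?p) ?p w)" if vw: "adj \<Gamma> v w" for v w
  proof -
    let ?t1 = "covering_transport (horizontal_graph X1 p1) p1 w"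
    let ?t2 = "covering_transport (horizontal_graph X2 p2) p2 w"
    have ne: "v \<noteq> w" using simple_graph_adjD(3)[OF G vw] .
    \<comment> \<open>All three transports are evaluated on the same data: the pair supplied by
      \<open>lifts\<close> is the lift in the pullback, and its coordinates are the lifts in
      \<open>X1\<close> and \<open>X2\<close>.\<close>
    have eq: "covering_transport (horizontal_graph ?B ?p) ?p w z = map_prod ?t1 ?t2 z"
      if zv: "z \<in> verts (fiber ?B ?p v)" for z
    proof -
      obtain x y where z: "z = (x, y)" by (cases z)
      have xy: "(x, y) \<in> verts ?B" "x \<in> verts X1" "y \<in> verts X2" "p1 x = v" "p2 y = v"
        using zv unfolding z
        by (auto simp: fiber_def preimage_boxplus) (auto simp: preimage_def verts_boxplus)
      obtain x' y' where l: "adj X1 x x'" "p1 x' = w" "adj X2 y y'" "p2 y' = w"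
        "adj ?B (x, y) (x', y')"
        using lifts[OF xy(1)] vw xy(4) by blast
      note lift1' = lift1[OF xy(2), unfolded xy(4), OF vw]
        and lift2' = lift2[OF xy(3), unfolded xy(5), OF vw]
      have pz: "?p (x, y) = v" "?p (x', y') = w"
        using xy(4) l(2) by (simp_all add: boxplus_proj_def)
      with vw have lift12: "\<exists>!u. adj ?B (x, y) u \<and> ?p u = w"
        using lift[OF xy(1)] by simp
      have "?t1 x = x'"
        using xy(4) ne by (intro transport_eqI[where p = p1, OF X1 lift1' l(1,2)]) simp
      moreover have "?t2 y = y'"
        using xy(5) ne by (intro transport_eqI[where p = p2, OF X2 lift2' l(3,4)]) simp
      moreover have "covering_transport (horizontal_graph ?B ?p) ?p w (x, y) = (x', y')"
        using pz ne by (intro transport_eqI[where p = ?p, OF B lift12 l(5)]) simp_all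
      ultimately show ?thesis by (simp add: z)
    qed
    have "graph_iso (fiber ?B ?p v) (fiber ?B ?p w) (map_prod ?t1 ?t2)"
      unfolding fiber_boxplus[OF G] by (rule graph_iso_cart_prod[OF t1[OF vw] t2[OF vw]])
    \<comment> \<open>The equation \<open>eq\<close> is known only on the vertices of the fiber over
      \<open>v\<close>, which is all that \<open>graph_iso\<close> inspects.\<close>
    then show ?thesis by (subst graph_iso_cong[where g = "map_prod ?t1 ?t2"]) (rule eq)
  qed
  show ?thesis
    unfolding graph_bundle_def
    using simple_graph_cart_prod[OF F1(1) F2(1)] F1(2) F2(2) B G surj iso cover transport
    by simp
qed

end
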